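(* For every $\varepsilon>0$ there exist infinitely many pairs $(N,\mathbf{v})$, where $N$ is a positive integer and $\mathbf{v}=(a,b,c)$ is a triple of integers with $0<a<b<c<N$ and $\gcd(N,a)=1$, such that $$\frac{\lambda^{\ast}(\Pi_{N,\mathbf{v}})}{N^{2/3}} > 2^{1/6}-\varepsilon.$$
   Context: For integers $N,a,b,c$ with $0<a<b<c<N$ and $\gcd(N,a)=1$, write $\mathbf{v}=(a,b,c)$ and define the point set $$\Pi_{N,\mathbf{v}}=\{(na \bmod N,\ nb \bmod N,\ nc \bmod N): 0\le n<N\}\subset[0,N-1]^3,$$ where $x \bmod N$ denotes the least nonnegative residue of $x$ modulo $N$. Define the shortest distance $$\lambda^{\ast}(\Pi_{N,\mathbf{v}})=\min_{\mathbf{x}\neq\mathbf{y},\ \mathbf{x},\mathbf{y}\in\Pi_{N,\mathbf{v}}}\|\mathbf{x}-\mathbf{y}\|,$$ with $\|\cdot\|$ the Euclidean norm. *)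

theory Defs
  imports "HOL-Analysis.Analysis"
begin

definition point_set :: "int \<Rightarrow> int \<times> int \<times> int \<Rightarrow> (real ^ 3) set" where
  "point_set N v = (case v of (a, b, c) \<Rightarrow>
     {vector [real_of_int (n * a mod N), real_of_int (n * b mod N), real_of_int (n * c mod N)]
      | n :: int. 0 \<le> n \<and> n < N})"

(* Min is the true minimum only for a finite set with at least two points. For point_set N (a, b, c)
   this holds when N > 1 and gcd N a = 1, since then the first coordinates are pairwise distinct. *)
definition shortest_distance :: "(real ^ 3) set \<Rightarrow> real" where
  "shortest_distance P = Min {norm (x - y) | x y. x \<in> P \<and> y \<in> P \<and> x \<noteq> y}"

end

theory Submission
  imports Defs
begin

text \<open>
  Up to scaling, the densest lattice packing in dimension three is attained by the face-centred cubic
  lattice of integer vectors with even coordinate sum. For \<open>s \<ge> 2\<close> take \<open>a = 1\<close>, \<open>b = s (2 s - 1)\<close>,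
  \<open>c = s (2 s + 1)\<close> and \<open>N = s (2 s - 1) (2 s + 1)\<close>. The differences of points lie in the lattice
  generated by \<open>(1, b, c)\<close> and the multiples of \<open>N\<close>. Its dual, scaled by \<open>N\<close>, has the basis
  \<open>(-s, s, s)\<close>, \<open>(s, -s, s - 1)\<close>, \<open>(s, s + 1, -s)\<close> and is a perturbed body-centred cubic lattice,
  so the lattice itself is a perturbed face-centred cubic one with spacing about \<open>2 s\<^sup>2\<close>. Its nonzero vectors have norm at
  least \<open>sqrt 2 s (2 s - 1)\<close>, and since \<open>N \<le> 4 s\<^sup>3\<close> the normalised distance is at least
  \<open>2 powr (1/6) (1 - 1/(2 s))\<close>.
\<close>

lemma power2_ge_of_abs_ge:
  fixes x m :: int
  assumes "0 \<le> m" "m \<le> \<bar>x\<bar>"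
  shows "m\<^sup>2 \<le> x\<^sup>2"
  using assms by (metis power2_abs power_mono)

text \<open>The integers \<open>w1\<close>, \<open>w2\<close>, \<open>w3\<close> of the proof are the face-centred cubic coordinates: the vector
  is close to \<open>2 s\<^sup>2 (w1, w2, w3)\<close>, and \<open>w1 + w2 + w3\<close> is even.\<close>

lemma perturbed_fcc_norm_ge:
  fixes s x y z k l :: int
  assumes s: "s \<ge> 1"
    and y: "y = s * (2 * s - 1) * (x + (2 * s + 1) * k)"
    and z: "z = s * (2 * s + 1) * (x + (2 * s - 1) * l)"
    and nz: "x \<noteq> 0 \<or> y \<noteq> 0 \<or> z \<noteq> 0"
  shows "2 * (s * (2 * s - 1))\<^sup>2 \<le> x\<^sup>2 + y\<^sup>2 + z\<^sup>2"
proof -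
  define w1 w2 w3 where "w1 = k - l" and "w2 = x + (2 * s + 1) * k" and "w3 = x + (2 * s - 1) * l"
  define b t where "b = s * (2 * s - 1)" and "t = (4 * s\<^sup>2 - 1) * w1"
  have yw: "y = b * w2" and zw: "z = s * (2 * s + 1) * w3"
    by (simp_all add: y z b_def w2_def w3_def)
  \<comment> \<open>Eliminating \<open>k\<close> and \<open>l\<close> leaves \<open>x\<close> within
    O(s) of half of \<open>t\<close>, for bounded \<open>w2\<close> and \<open>w3\<close>.\<close>
  have xw: "2 * x = t - (2 * s - 1) * w2 + (2 * s + 1) * w3"
    by (simp add: t_def w1_def w2_def w3_def algebra_simps power2_eq_square)
  have par: "even (w1 + w2 + w3)"
    by (auto simp: w1_def w2_def w3_def)
  have ss: "s \<le> s\<^sup>2" using s by (simp add: power2_eq_square)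
  have b0: "0 \<le> b" using s by (simp add: b_def)
  have bs: "b = 2 * s\<^sup>2 - s" by (simp add: b_def algebra_simps power2_eq_square)
  have y_ge: "(m * b)\<^sup>2 \<le> y\<^sup>2" if "0 \<le> m" "m \<le> \<bar>w2\<bar>" for m
    using that b0 by (intro power2_ge_of_abs_ge) (auto simp: yw abs_mult mult.commute mult_left_mono)
  have z_ge: "(m * (s * (2 * s + 1)))\<^sup>2 \<le> z\<^sup>2" if "0 \<le> m" "m \<le> \<bar>w3\<bar>" for m
    using that s by (intro power2_ge_of_abs_ge) (auto simp: zw abs_mult mult.commute mult_left_mono)
  have t_ge: "(4 * s\<^sup>2 - 1) * m \<le> \<bar>t\<bar>" if "m \<le> \<bar>w1\<bar>" for m
    using that s ss by (auto simp: t_def abs_mult intro!: mult_left_mono)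
  have cb: "b\<^sup>2 \<le> (s * (2 * s + 1))\<^sup>2"
    using s b0 by (intro power_mono) (auto simp: b_def)
  note sq = zero_le_power2[of x] zero_le_power2[of y] zero_le_power2[of z]
  \<comment> \<open>Two nonzero coordinates among \<open>w2\<close>, \<open>w3\<close> suffice
    through \<open>y\<close> and \<open>z\<close> alone. If just one is nonzero, it is at least 2 in
    absolute value or parity makes \<open>w1\<close> odd, so \<open>x\<close> contributes. If both
    vanish, \<open>w1\<close> is even and nonzero.\<close>
  consider "w2 \<noteq> 0" "w3 \<noteq> 0" | "w2 \<noteq> 0" "w3 = 0" | "w2 = 0" "w3 \<noteq> 0" | "w2 = 0" "w3 = 0" by blast
  then have "2 * b\<^sup>2 \<le> x\<^sup>2 + y\<^sup>2 + z\<^sup>2"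
  proof cases
    case 1
    then have "b\<^sup>2 \<le> y\<^sup>2" "(s * (2 * s + 1))\<^sup>2 \<le> z\<^sup>2"
      using y_ge[of 1] z_ge[of 1] by auto
    then show ?thesis using sq cb by linarith
  next
    case 2
    show ?thesis
    proof (cases "2 \<le> \<bar>w2\<bar>")
      case True
      then have "4 * b\<^sup>2 \<le> y\<^sup>2" using y_ge[of 2] by (simp add: power_mult_distrib)
      then show ?thesis using sq by linarith
    next
      case False
      then have w2: "w2 = 1 \<or> w2 = -1" using 2 by auto
      then have "odd w1" using par 2 by auto
      then have "1 \<le> \<bar>w1\<bar>" by (cases "w1 = 0") auto
      then have "4 * s\<^sup>2 - 1 \<le> \<bar>t\<bar>" using t_ge[of 1] by simp
      \<comment> \<open>Here 2|x| is at least (4 s^2 - 1) - (2 s - 1), which is exactly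
        \<open>2 * b\<close>.\<close>
      then have "b \<le> \<bar>x\<bar>" using xw w2 2 bs s by auto
      then have "b\<^sup>2 \<le> x\<^sup>2" using b0 power2_ge_of_abs_ge by blast
      moreover have "b\<^sup>2 \<le> y\<^sup>2" using y_ge[of 1] 2 by auto
      ultimately show ?thesis using sq by linarith
    qed
  next
    case 3
    show ?thesis
    proof (cases "2 \<le> \<bar>w3\<bar>")
      case True
      then have "4 * (s * (2 * s + 1))\<^sup>2 \<le> z\<^sup>2" using z_ge[of 2] by (simp add: power_mult_distrib)
      then show ?thesis using sq cb by linarith
    next
      case False
      then have w3: "w3 = 1 \<or> w3 = -1" using 3 by auto
      then have "odd w1" using par 3 by auto
      then have "1 \<le> \<bar>w1\<bar>" by (cases "w1 = 0") auto
      then have "4 * s\<^sup>2 - 1 \<le> \<bar>t\<bar>" using t_ge[of 1] by simp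
      \<comment> \<open>The correction is now \<open>2 * s + 1\<close>, so the bound on |x| is only
        \<open>b - 1\<close>; the surplus \<open>2 * s\<close> of \<open>s * (2 * s + 1)\<close>
        over \<open>b\<close> makes up for it.\<close>
      then have "2 * s\<^sup>2 - s - 1 \<le> \<bar>x\<bar>" using xw w3 3 s by auto
      then have x2: "(2 * s\<^sup>2 - s - 1)\<^sup>2 \<le> x\<^sup>2"
        using s ss by (intro power2_ge_of_abs_ge) auto
      have z2: "(s * (2 * s + 1))\<^sup>2 \<le> z\<^sup>2" using z_ge[of 1] 3 by auto
      have "(2 * s\<^sup>2 - s - 1)\<^sup>2 + (s * (2 * s + 1))\<^sup>2 - 2 * b\<^sup>2
          = 4 * (s * s * (s - 1)) + 4 * s ^ 3 + 2 * s + 1"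
        by (simp add: b_def algebra_simps power2_eq_square power3_eq_cube)
      also have "\<dots> \<ge> 0" using s by simp
      finally show ?thesis using sq x2 z2 by linarith
    qed
  next
    case 4
    then have "y = 0" "z = 0" by (simp_all add: yw zw)
    then have "w1 \<noteq> 0" using nz xw 4 by (auto simp: t_def)
    moreover have "even w1" using par 4 by auto
    ultimately have "2 \<le> \<bar>w1\<bar>" by (cases "w1 = 1 \<or> w1 = -1") auto
    then have "2 * (4 * s\<^sup>2 - 1) \<le> \<bar>t\<bar>" using t_ge[of 2] by simp
    then have "2 * b \<le> \<bar>x\<bar>" using xw 4 s bs by auto
    then have "(2 * b)\<^sup>2 \<le> x\<^sup>2" using b0 by (intro power2_ge_of_abs_ge) auto
    then have "4 * b\<^sup>2 \<le> x\<^sup>2" by (simp add: power_mult_distrib)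
    then show ?thesis using sq zero_le_power2[of b] by linarith
  qed
  then show ?thesis by (simp add: b_def)
qed

lemma norm_vector_3:
  fixes x y z :: real
  shows "norm (vector [x, y, z] :: real ^ 3) = sqrt (x\<^sup>2 + y\<^sup>2 + z\<^sup>2)"
  by (simp add: norm_vec_def L2_set_def sum_3)

lemma vector_3_diff:
  fixes x y z x' y' z' :: real
  shows "(vector [x, y, z] - vector [x', y', z'] :: real ^ 3) = vector [x - x', y - y', z - z']"
  by (simp add: vec_eq_iff forall_3)

lemma finite_point_set: "finite (point_set N v)"
proof -
  obtain a b c where v: "v = (a, b, c)" by (cases v)
  have "point_set N v = (\<lambda>n. vector [real_of_int (n * a mod N), real_of_int (n * b mod N),
      real_of_int (n * c mod N)]) ` {0..<N}"
    by (auto simp: point_set_def v)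
  then show ?thesis by simp
qed

text \<open>The distances form a finite set, and the pair \<open>p\<close>, \<open>q\<close> makes
  it nonempty, so \<open>Min\<close> is a true minimum.\<close>

lemma shortest_distance_ge:
  assumes "finite P" "p \<in> P" "q \<in> P" "p \<noteq> q"
    and "\<And>x y. x \<in> P \<Longrightarrow> y \<in> P \<Longrightarrow> x \<noteq> y \<Longrightarrow> d \<le> norm (x - y)"
  shows "d \<le> shortest_distance P"
proof -
  let ?D = "{norm (x - y) | x y. x \<in> P \<and> y \<in> P \<and> x \<noteq> y}"
  have "?D \<subseteq> (\<lambda>(x, y). norm (x - y)) ` (P \<times> P)" by auto
  then have "finite ?D" using assms(1) by (meson finite_SigmaI finite_imageI finite_subset)
  moreover have "?D \<noteq> {}" using assms(2-4) by blast
  ultimately show ?thesis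
    unfolding shortest_distance_def using assms(5) by (subst Min_ge_iff) auto
qed

text \<open>Reduction modulo \<open>N\<close> shifts a coordinate by a multiple of \<open>N\<close>;
  this places differences of points in the lattice.\<close>

lemma mod_diff_mod_eq:
  fixes m n b N :: int
  obtains k where "m * b mod N - n * b mod N = b * (m - n) + N * k"
proof
  show "m * b mod N - n * b mod N = b * (m - n) + N * (n * b div N - m * b div N)"
    by (simp add: algebra_simps minus_div_mult_eq_mod[symmetric])
qed

lemma shortest_distance_perturbed_fcc:
  fixes s :: int
  assumes s: "s \<ge> 2"
  shows "sqrt 2 * (s * (2 * s - 1))
    \<le> shortest_distance (point_set (s * (2 * s - 1) * (2 * s + 1)) (1, s * (2 * s - 1), s * (2 * s + 1)))"
proof -
  define b c N where "b = s * (2 * s - 1)" and "c = s * (2 * s + 1)" and "N = s * (2 * s - 1) * (2 * s + 1)"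
  let ?pt = "\<lambda>n. vector [real_of_int (n * 1 mod N), real_of_int (n * b mod N),
      real_of_int (n * c mod N)] :: real ^ 3"
  have b: "b \<ge> 1" using s mult_mono[of 1 s 1 "2 * s - 1"] by (simp add: b_def)
  have N: "N = b * (2 * s + 1)" "N = c * (2 * s - 1)" by (simp_all add: N_def b_def c_def)
  have "1 * 5 \<le> b * (2 * s + 1)" using s b by (intro mult_mono) auto
  then have N1: "N > 1" by (simp add: N(1))
  have P: "point_set N (1, b, c) = {?pt n | n. 0 \<le> n \<and> n < N}"
    by (simp add: point_set_def)
  have "sqrt 2 * b \<le> shortest_distance (point_set N (1, b, c))"
  proof (rule shortest_distance_ge[OF finite_point_set])
    have pt: "?pt n \<in> point_set N (1, b, c)" if "0 \<le> n" "n < N" for n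
      unfolding P using that by blast
    show "?pt 0 \<in> point_set N (1, b, c)" "?pt 1 \<in> point_set N (1, b, c)"
      using N1 by (intro pt; linarith)+
    show "?pt 0 \<noteq> ?pt 1" using N1 by (simp add: vec_eq_iff forall_3)
  next
    fix p q
    assume pq: "p \<in> point_set N (1, b, c)" "q \<in> point_set N (1, b, c)" "p \<noteq> q"
    obtain m n where m: "0 \<le> m" "m < N" "p = ?pt m" and n: "0 \<le> n" "n < N" "q = ?pt n"
      using pq(1,2) unfolding P by blast
    have "m \<noteq> n" using pq(3) m n by auto
    \<comment> \<open>Since \<open>a\<close> is 1 and the indices lie below \<open>N\<close>, the
      first coordinate of the difference is \<open>m - n\<close> itself, hence nonzero.\<close>
    define x y z where "x = m - n" and "y = m * b mod N - n * b mod N"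
      and "z = m * c mod N - n * c mod N"
    obtain k where "y = b * x + N * k" unfolding x_def y_def by (rule mod_diff_mod_eq)
    then have y: "y = s * (2 * s - 1) * (x + (2 * s + 1) * k)"
      by (simp add: N_def b_def algebra_simps)
    obtain l where "z = c * x + N * l" unfolding x_def z_def by (rule mod_diff_mod_eq)
    then have z: "z = s * (2 * s + 1) * (x + (2 * s - 1) * l)"
      by (simp add: N_def c_def algebra_simps)
    have "x \<noteq> 0" using \<open>m \<noteq> n\<close> by (simp add: x_def)
    then have "2 * b\<^sup>2 \<le> x\<^sup>2 + y\<^sup>2 + z\<^sup>2"
      unfolding b_def using s by (intro perturbed_fcc_norm_ge[OF _ y z]) auto
    then have "real_of_int (2 * b\<^sup>2) \<le> real_of_int (x\<^sup>2 + y\<^sup>2 + z\<^sup>2)" by (simp only: of_int_le_iff)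
    then have "sqrt (2 * (real_of_int b)\<^sup>2) \<le> sqrt ((real_of_int x)\<^sup>2 + (real_of_int y)\<^sup>2 + (real_of_int z)\<^sup>2)"
      by (intro real_sqrt_le_mono) simp
    moreover have "p - q = vector [real_of_int x, real_of_int y, real_of_int z]"
      using m n by (simp add: vector_3_diff x_def y_def z_def)
    ultimately show "sqrt 2 * b \<le> norm (p - q)"
      using b by (simp add: norm_vector_3 real_sqrt_mult)
  qed
  then show ?thesis by (simp add: b_def c_def N_def)
qed

text \<open>The denominator is bounded by (4 s^3)^(2/3) = 2^(4/3) s^2, and the constant comes from
  1/2 + 1 = 1/6 + 4/3 in the exponents of 2.\<close>

lemma perturbed_fcc_ratio:
  fixes s :: real
  assumes s: "s \<ge> 1"
  shows "2 powr (1/6) * (1 - 1 / (2 * s))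
    \<le> sqrt 2 * (s * (2 * s - 1)) / (s * (2 * s - 1) * (2 * s + 1)) powr (2/3)"
proof -
  define N where "N = s * (2 * s - 1) * (2 * s + 1)"
  have N0: "N > 0" using s by (simp add: N_def)
  have "N \<le> 4 * s ^ 3" using s by (simp add: N_def algebra_simps power3_eq_cube)
  then have "N powr (2/3) \<le> (4 * s ^ 3) powr (2/3)" using N0 by (intro powr_mono2) auto
  also have "\<dots> = 2 powr (4/3) * s\<^sup>2"
  proof -
    have "(4::real) = 2 powr 2" by simp
    then have "(4::real) powr (2/3) = 2 powr (4/3)" by (simp only: powr_powr) simp
    moreover have "(s ^ 3) powr (2/3) = s\<^sup>2"
      using s by (simp add: powr_powr flip: powr_numeral)
    ultimately show ?thesis using s by (simp add: powr_mult)
  qed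
  finally have Np: "N powr (2/3) \<le> 2 powr (4/3) * s\<^sup>2" .
  have "sqrt 2 * 2 = 2 powr (1/6) * 2 powr (4/3)"
    by (simp add: powr_half_sqrt[symmetric] powr_mult_base mult.commute flip: powr_add)
  then have "2 powr (1/6) * (1 - 1 / (2 * s)) * (2 powr (4/3) * s\<^sup>2) = sqrt 2 * 2 * (1 - 1 / (2 * s)) * s\<^sup>2"
    by (simp add: mult_ac)
  also have "\<dots> = sqrt 2 * (s * (2 * s - 1))"
    using s by (simp add: field_simps power2_eq_square)
  finally have "2 powr (1/6) * (1 - 1 / (2 * s)) * (2 powr (4/3) * s\<^sup>2) = sqrt 2 * (s * (2 * s - 1))" .
  moreover have "2 powr (1/6) * (1 - 1 / (2 * s)) * N powr (2/3)
      \<le> 2 powr (1/6) * (1 - 1 / (2 * s)) * (2 powr (4/3) * s\<^sup>2)"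
    using s by (intro mult_left_mono Np mult_nonneg_nonneg) (auto simp: field_simps)
  ultimately show ?thesis
    using N0 by (simp add: pos_le_divide_eq flip: N_def)
qed

theorem theorem1:
  fixes \<epsilon> :: real
  assumes "\<epsilon> > 0"
  shows "infinite {(N :: int, (a :: int, b :: int, c :: int)).
           0 < N \<and> 0 < a \<and> a < b \<and> b < c \<and> c < N \<and> gcd N a = 1 \<and>
           shortest_distance (point_set N (a, b, c)) / real_of_int N powr (2 / 3)
             > 2 powr (1 / 6) - \<epsilon>}"
    (is "infinite ?S")
proof -
  \<comment> \<open>From \<open>s0\<close> on, the loss 2^(1/6)/(2 s) stays below \<epsilon>, with a
    factor 2 to spare.\<close>
  obtain s0 :: int where s0: "2 powr (1/6) / \<epsilon> < s0" using ex_less_of_int by blast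
  define f :: "int \<Rightarrow> int \<times> int \<times> int \<times> int"
    where "f s = (s * (2 * s - 1) * (2 * s + 1), 1, s * (2 * s - 1), s * (2 * s + 1))" for s
  \<comment> \<open>The value s = 1 is excluded because it gives a = b = 1 and c = N = 3.\<close>
  have "f s \<in> ?S" if "s \<in> {max s0 2..}" for s
  proof -
    have s: "s \<ge> 2" "s0 \<le> s" using that by auto
    define N where "N = s * (2 * s - 1) * (2 * s + 1)"
    define d where "d = shortest_distance (point_set N (1, s * (2 * s - 1), s * (2 * s + 1)))"
    have b: "1 < s * (2 * s - 1)" using s mult_mono[of 2 s 1 "2 * s - 1"] by simp
    have "s * (2 * s + 1) * 1 < s * (2 * s + 1) * (2 * s - 1)"
      using s by (intro mult_strict_left_mono) auto
    then have c: "s * (2 * s + 1) < N" by (simp add: N_def mult_ac)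
    have bc: "s * (2 * s - 1) < s * (2 * s + 1)" using s by simp
    have "2 powr (1/6) / \<epsilon> < real_of_int s" using s0 s(2) by linarith
    then have "2 powr (1/6) < \<epsilon> * s" using assms by (simp add: field_simps)
    also have "\<dots> \<le> \<epsilon> * (2 * s)" using assms s by simp
    finally have "2 powr (1/6) / (2 * s) < \<epsilon>" using s by (simp add: field_simps)
    then have "2 powr (1/6) - \<epsilon> < 2 powr (1/6) * (1 - 1 / (2 * s))"
      by (simp add: right_diff_distrib)
    also have "\<dots> \<le> sqrt 2 * (s * (2 * s - 1)) / N powr (2/3)"
      using perturbed_fcc_ratio[of s] s by (simp add: N_def)
    also have "\<dots> \<le> d / N powr (2/3)"
      using shortest_distance_perturbed_fcc[OF s(1)] by (intro divide_right_mono) (simp_all add: N_def d_def)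
    finally have "2 powr (1/6) - \<epsilon> < d / N powr (2/3)" .
    then show ?thesis using b bc c by (simp add: f_def N_def d_def)
  qed
  then have "f ` {max s0 2..} \<subseteq> ?S" by (rule image_subsetI)
  \<comment> \<open>The parameter is recovered from c - b = 2 s.\<close>
  moreover have "inj_on f {max s0 2..}"
  proof (rule inj_onI)
    fix s t assume "f s = f t"
    then have "s * (2 * s + 1) - s * (2 * s - 1) = t * (2 * t + 1) - t * (2 * t - 1)"
      unfolding f_def by (metis Pair_inject)
    then show "s = t" by (simp add: algebra_simps)
  qed
  then have "infinite (f ` {max s0 2..})"
    by (simp add: finite_image_iff infinite_Ici)
  ultimately show ?thesis by (rule infinite_super)
qed

end
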